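(* Let $p$ be a prime, $k$ a field of characteristic $p$, $\gamma\in k$ a root of unity of order $q\ge1$, and $g(\zeta)=\gamma\zeta+a_2\zeta^2+\cdots$ a power series in $k[[\zeta]]$. Then $i_0(g^q)$ is divisible by $q$ when finite. Furthermore, for every integer $n\ge1$ such that $i_n(g^q)$ is finite, $i_{n-1}(g^q)$ is also finite and $i_n(g^q)\equiv i_{n-1}(g^q)\pmod{qp^n}$. In particular, for every $n\ge0$ with $i_n(g^q)$ finite, $i_n(g^q)$ is divisible by $q$.
   Context: $\mathrm{ord}$ denotes the lowest degree of a nonzero term of a power series in $k[[\zeta]]$, with $\mathrm{ord}(0)=+\infty$. For $h(\zeta)=\zeta+\cdots\in k[[\zeta]]$ and $n\ge0$, $i_n(h)=\mathrm{ord}\big((h^{p^n}(\zeta)-\zeta)/\zeta\big)$, where $h^m$ denotes the $m$-th compositional iterate. *)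

theory Defs
  imports "HOL-Computational_Algebra.Formal_Power_Series" "HOL-Library.Extended_Nat"
begin

definition fps_ord :: "'a::zero fps \<Rightarrow> enat" where
  "fps_ord f = (if f = 0 then \<infinity> else enat (subdegree f))"

definition fps_iter :: "'a::comm_ring_1 fps \<Rightarrow> nat \<Rightarrow> 'a fps" where
  "fps_iter h m = ((\<lambda>f. h oo f) ^^ m) fps_X"

text \<open>i_n(h) = ord((h^(p^n)(zeta) - zeta)/zeta); division by zeta is fps_shift 1
  (exact, as h^(p^n) - zeta has zero constant term when h = zeta + ...).\<close>
definition i_index :: "nat \<Rightarrow> nat \<Rightarrow> 'a::comm_ring_1 fps \<Rightarrow> enat" where
  "i_index p n h = fps_ord (fps_shift 1 (fps_iter h (p ^ n) - fps_X))"

end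

theory Submission
  imports Defs "HOL-Number_Theory.Cong"
begin

text \<open>
  The congruence modulo \<open>p ^ n\<close> is Sen's theorem, proved here by Sen's argument. Let \<open>h = g ^ q\<close>
  (an iterate), which is tangent to the identity, let \<open>D f = f(h) - f\<close>, and let \<open>v\<close> be the p-adic
  valuation. The product \<open>x m\<close> of the iterates \<open>h ^ j\<close> with \<open>j < m\<close> has order \<open>m\<close>, and \<open>D (x m)\<close>
  has order \<open>m + i (v m)\<close>, because the product telescopes. If the congruences hold below \<open>n\<close>, the
  numbers \<open>m + i (v m)\<close> with \<open>v m < n\<close> are pairwise distinct and never congruent to \<open>i (n - 1)\<close>
  modulo \<open>p ^ n\<close>.

  Suppose that \<open>i n - i (n - 1)\<close> has valuation \<open>s < n\<close>. Choose \<open>a > 0\<close> congruent to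
  \<open>i (n - 1) - i n\<close> modulo \<open>p ^ n\<close>, so \<open>v a = s\<close>, and let \<open>w\<close> be the product \<open>x a\<close> formed with the
  iterate \<open>h ^ p ^ (n - s)\<close> in place of \<open>h\<close>. The sum \<open>y\<close> of the \<open>w(h ^ j)\<close> with \<open>j < p ^ (n - s)\<close>
  has order greater than \<open>a\<close>, while \<open>D y\<close> has order \<open>a + i n\<close>. Expanding \<open>y\<close> in the \<open>x m\<close> with
  \<open>m > a\<close>, the terms with \<open>v m \<ge> n\<close> contribute to \<open>D y\<close> only in orders above \<open>a + i n\<close>. Hence
  \<open>a + i n = m + i (v m)\<close> for some \<open>m\<close> with \<open>v m < n\<close>, although \<open>a + i n\<close> is congruent to
  \<open>i (n - 1)\<close>: a contradiction.

  Divisibility by \<open>q\<close> comes from comparing leading terms in \<open>g(H) = H(g)\<close> for an iterate \<open>H\<close> of \<open>h\<close>,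
  and \<open>q\<close> is coprime to \<open>p\<close> because the Frobenius map is injective.
\<close>

unbundle fps_syntax

section \<open>Orders of power series under composition\<close>

text \<open>Lower bounds on orders are expressed as divisibility by \<open>fps_X ^ n\<close>, which
  also covers the zero series, whose \<open>subdegree\<close> is 0.\<close>

lemma fps_X_power_dvd_iff_nth:
  fixes f :: "'a::comm_ring_1 fps"
  shows "fps_X ^ n dvd f \<longleftrightarrow> (\<forall>k<n. f $ k = 0)"
proof
  assume "fps_X ^ n dvd f"
  then show "\<forall>k<n. f $ k = 0" by (auto simp: fps_X_power_mult_nth)
next
  assume *: "\<forall>k<n. f $ k = 0"
  have "f = fps_X ^ n * fps_shift n f"
    using * by (intro fps_ext) (auto simp: fps_X_power_mult_nth)
  then show "fps_X ^ n dvd f" by (metis dvd_triv_left)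
qed

lemma fps_X_power_dvd_mono:
  fixes f :: "'a::comm_ring_1 fps"
  shows "fps_X ^ n dvd f \<Longrightarrow> m \<le> n \<Longrightarrow> fps_X ^ m dvd f"
  by (auto simp: fps_X_power_dvd_iff_nth)

lemma subdegree_eq_iff_fps_X_power_dvd:
  fixes f :: "'a::comm_ring_1 fps"
  shows "f \<noteq> 0 \<and> subdegree f = n \<longleftrightarrow> fps_X ^ n dvd f \<and> f $ n \<noteq> 0"
  by (auto simp: fps_X_power_dvd_iff_nth intro: subdegreeI)

lemma fps_X_power_dvd_power_diff:
  fixes h :: "'a::comm_ring_1 fps"
  assumes h: "fps_X ^ Suc r dvd h - fps_X"
  shows "fps_X ^ (k + r) dvd h ^ k - fps_X ^ k"
proof (induction k)
  case (Suc k)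
  have "fps_X dvd h - fps_X" using fps_X_power_dvd_mono[OF h, of 1] by simp
  then have "fps_X dvd h" by (metis dvd_add_left_iff dvd_refl diff_add_cancel)
  then have "fps_X * fps_X ^ (k + r) dvd h * (h ^ k - fps_X ^ k)"
    using Suc.IH by (rule mult_dvd_mono)
  moreover have "fps_X ^ Suc r * fps_X ^ k dvd (h - fps_X) * fps_X ^ k"
    using h by (rule mult_dvd_mono) simp
  moreover have "h ^ Suc k - fps_X ^ Suc k = h * (h ^ k - fps_X ^ k) + (h - fps_X) * fps_X ^ k"
    by (simp add: algebra_simps)
  ultimately show ?case by (simp add: power_add mult_ac dvd_add)
qed simp

text \<open>Only the exponents \<open>i \<ge> m\<close> matter, and for these \<open>h ^ i\<close>
  agrees with \<open>fps_X ^ i\<close> below degree \<open>i + r\<close>.\<close>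

lemma fps_X_power_dvd_compose_diff:
  fixes h f :: "'a::comm_ring_1 fps"
  assumes h: "fps_X ^ Suc r dvd h - fps_X" and f: "fps_X ^ m dvd f"
  shows "fps_X ^ (m + r) dvd (f oo h) - f"
  unfolding fps_X_power_dvd_iff_nth
proof (intro allI impI)
  fix k assume k: "k < m + r"
  have "f $ i * (h ^ i $ k) = f $ i * (fps_X ^ i $ k)" for i
  proof (cases "i < m")
    case True
    then show ?thesis using f by (simp add: fps_X_power_dvd_iff_nth)
  next
    case False
    then have "k < i + r" using k by simp
    then have "(h ^ i - fps_X ^ i) $ k = 0"
      using fps_X_power_dvd_power_diff[OF h, of i] fps_X_power_dvd_iff_nth by blast
    then show ?thesis by simp
  qed
  then have "(f oo h) $ k = (f oo fps_X) $ k" unfolding fps_compose_nth by simp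
  then show "((f oo h) - f) $ k = 0" by simp
qed

lemma fps_X_power_dvd_compose:
  fixes h f :: "'a::comm_ring_1 fps"
  assumes "h $ 0 = 0" and "fps_X ^ m dvd f"
  shows "fps_X ^ m dvd f oo h" and "(f oo h) $ m = f $ m * (h $ 1) ^ m"
proof -
  have f: "f $ i = 0" if "i < m" for i using assms(2) that by (simp add: fps_X_power_dvd_iff_nth)
  show "fps_X ^ m dvd f oo h"
    unfolding fps_X_power_dvd_iff_nth fps_compose_nth using f by (auto intro!: sum.neutral)
  have "(f oo h) $ m = (\<Sum>i\<in>{m}. f $ i * h ^ i $ m)"
    unfolding fps_compose_nth by (rule sum.mono_neutral_right) (auto simp: f)
  then show "(f oo h) $ m = f $ m * (h $ 1) ^ m"
    using startsby_zero_power_nth_same[OF assms(1)] by simp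
qed

section \<open>Compositional iterates\<close>

lemma fps_iter_0 [simp]: "fps_iter h 0 = fps_X"
  by (simp add: fps_iter_def)

lemma fps_iter_Suc: "fps_iter h (Suc m) = h oo fps_iter h m"
  by (simp add: fps_iter_def)

lemma fps_iter_nth_0 [simp]: "h $ 0 = 0 \<Longrightarrow> fps_iter h m $ 0 = 0"
  by (induction m) (simp_all add: fps_iter_Suc)

lemma fps_iter_nth_1: "h $ 0 = 0 \<Longrightarrow> fps_iter h m $ 1 = (h $ 1) ^ m"
proof (induction m)
  case (Suc m)
  have "fps_X ^ 1 dvd h" unfolding fps_X_power_dvd_iff_nth using Suc.prems by simp
  from fps_X_power_dvd_compose(2)[OF _ this, of "fps_iter h m"] Suc show ?case
    by (simp add: fps_iter_Suc)
qed simp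

lemma fps_iter_add:
  fixes h :: "'a::idom fps"
  assumes "h $ 0 = 0"
  shows "fps_iter h (m + n) = fps_iter h m oo fps_iter h n"
proof (induction m)
  case 0
  then show ?case using assms by simp
next
  case (Suc m)
  then show ?case using assms by (simp add: fps_iter_Suc fps_compose_assoc)
qed

lemma fps_iter_mult:
  fixes h :: "'a::idom fps"
  assumes "h $ 0 = 0"
  shows "fps_iter h (m * n) = fps_iter (fps_iter h m) n"
proof (induction n)
  case (Suc n)
  then show ?case using assms fps_iter_add[OF assms, of m "m * n"] by (simp add: fps_iter_Suc)
qed simp

text \<open>One more iteration adds \<open>h - fps_X\<close> up to an error of order at least
  \<open>2 * r + 1\<close>, which exceeds \<open>r + 1\<close> because \<open>r \<ge> 1\<close>.
  Hence iterating \<open>u\<close> times keeps the order whenever the characteristic does not divide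
  \<open>u\<close> and the coefficient of \<open>h - fps_X\<close> at \<open>Suc r\<close> is
  nonzero.\<close>

lemma fps_iter_diff_X:
  fixes h :: "'a::idom fps"
  assumes "h $ 0 = 0" and h: "fps_X ^ Suc r dvd h - fps_X" and "r \<ge> 1"
  shows "fps_X ^ Suc r dvd fps_iter h u - fps_X"
    and "(fps_iter h u - fps_X) $ Suc r = of_nat u * (h - fps_X) $ Suc r"
proof -
  have "fps_X ^ Suc r dvd fps_iter h u - fps_X \<and>
    (fps_iter h u - fps_X) $ Suc r = of_nat u * (h - fps_X) $ Suc r"
  proof (induction u)
    case (Suc u)
    let ?E = "fps_iter h u - fps_X"
    define F where "F = (?E oo h) - ?E"
    have eq: "fps_iter h (Suc u) - fps_X = F + (?E + (h - fps_X))"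
      unfolding F_def
      using fps_iter_add[OF assms(1), of u 1] assms(1)
      by (simp add: fps_compose_sub_distrib fps_iter_Suc)
    have *: "fps_X ^ (Suc r + r) dvd F"
      unfolding F_def by (rule fps_X_power_dvd_compose_diff[OF h]) (use Suc in auto)
    then have "F $ Suc r = 0"
      unfolding fps_X_power_dvd_iff_nth using \<open>r \<ge> 1\<close> by auto
    moreover have "fps_X ^ Suc r dvd F"
      using * by (rule fps_X_power_dvd_mono) simp
    ultimately show ?case
      unfolding eq fps_add_nth[of F] fps_add_nth[of ?E] of_nat_Suc distrib_right
      using Suc h by (metis dvd_add add_0 add.commute mult_1)
  qed simp
  then show "fps_X ^ Suc r dvd fps_iter h u - fps_X"
    and "(fps_iter h u - fps_X) $ Suc r = of_nat u * (h - fps_X) $ Suc r" by auto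
qed

section \<open>Products of iterates\<close>

definition iter_prod :: "'a::comm_ring_1 fps \<Rightarrow> nat \<Rightarrow> 'a fps" where
  "iter_prod h m = (\<Prod>j<m. fps_iter h j)"

text \<open>Composing with \<open>h\<close> turns each factor into the next one, so multiplying by
  the lost factor \<open>fps_X\<close> gives the product of length \<open>Suc m\<close>.\<close>

lemma iter_prod_compose_diff:
  fixes h :: "'a::idom fps"
  assumes "h $ 0 = 0"
  shows "fps_X * ((iter_prod h m oo h) - iter_prod h m) = iter_prod h m * (fps_iter h m - fps_X)"
proof -
  have "iter_prod h m oo h = (\<Prod>j<m. fps_iter h (Suc j))"
    unfolding iter_prod_def fps_compose_prod_distrib[OF assms]
    using fps_iter_add[OF assms, of _ 1] assms by (simp add: fps_iter_Suc)
  then have "fps_X * (iter_prod h m oo h) = (\<Prod>j<Suc m. fps_iter h j)"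
    by (simp add: prod.lessThan_Suc_shift del: prod.lessThan_Suc)
  also have "\<dots> = iter_prod h m * fps_iter h m"
    by (simp add: iter_prod_def)
  finally show ?thesis by (simp add: algebra_simps)
qed

lemma iter_prod_leading:
  fixes h :: "'a::idom fps"
  assumes "h $ 0 = 0" "h $ 1 = 1"
  shows "fps_X ^ m dvd iter_prod h m" "iter_prod h m $ m = 1"
proof -
  have "fps_X ^ m dvd iter_prod h m \<and> iter_prod h m $ m = 1"
  proof (induction m)
    case 0
    then show ?case by (simp add: iter_prod_def)
  next
    case (Suc m)
    have eq: "iter_prod h (Suc m) = iter_prod h m * fps_iter h m"
      by (simp add: iter_prod_def)
    have 1: "fps_iter h m $ Suc 0 = 1" "fps_iter h m $ 0 = 0"
      using assms fps_iter_nth_1[of h m] by simp_all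
    then have "subdegree (fps_iter h m) = 1" "fps_iter h m \<noteq> 0"
      by (auto intro!: subdegreeI)
    moreover have "subdegree (iter_prod h m) = m" "iter_prod h m \<noteq> 0"
      using Suc subdegree_eq_iff_fps_X_power_dvd[of "iter_prod h m" m] by auto
    ultimately have "subdegree (iter_prod h (Suc m)) = Suc m" "iter_prod h (Suc m) \<noteq> 0"
      and "iter_prod h (Suc m) $ Suc m = 1"
      unfolding eq using nth_subdegree_mult[of "iter_prod h m" "fps_iter h m"] Suc 1 by simp_all
    then show ?case
      using subdegree_eq_iff_fps_X_power_dvd[of "iter_prod h (Suc m)" "Suc m"] by blast
  qed
  then show "fps_X ^ m dvd iter_prod h m" "iter_prod h m $ m = 1" by auto
qed

text \<open>Cancel \<open>fps_X\<close> in the telescoped identity; \<open>iter_prod h m\<close>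
  contributes order \<open>m\<close> and leading coefficient 1.\<close>

lemma fps_X_power_dvd_iter_prod_diff:
  fixes h :: "'a::idom fps"
  assumes "h $ 0 = 0" "h $ 1 = 1" "fps_X ^ Suc r dvd fps_iter h m - fps_X"
  shows "fps_X ^ (m + r) dvd (iter_prod h m oo h) - iter_prod h m"
    and "((iter_prod h m oo h) - iter_prod h m) $ (m + r) = (fps_iter h m - fps_X) $ Suc r"
proof -
  let ?D = "(iter_prod h m oo h) - iter_prod h m"
  obtain u where u: "iter_prod h m = fps_X ^ m * u" using iter_prod_leading(1)[OF assms(1,2)] by blast
  obtain v where v: "fps_iter h m - fps_X = fps_X ^ Suc r * v" using assms(3) by blast
  have "fps_X * ?D = (fps_X ^ m * u) * (fps_X ^ Suc r * v)"
    by (simp only: iter_prod_compose_diff[OF assms(1)] flip: u v)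
  also have "\<dots> = fps_X * (fps_X ^ (m + r) * (u * v))"
    by (simp add: power_add mult_ac)
  finally have "fps_X * ?D = fps_X * (fps_X ^ (m + r) * (u * v))" .
  then have D: "?D = fps_X ^ (m + r) * (u * v)" by simp
  then show "fps_X ^ (m + r) dvd ?D" by simp
  have "u $ 0 = 1"
    using iter_prod_leading(2)[OF assms(1,2), of m] unfolding u by (simp add: fps_X_power_mult_nth)
  then show "?D $ (m + r) = (fps_iter h m - fps_X) $ Suc r"
    unfolding D v fps_X_power_mult_nth by simp
qed

section \<open>Expansions and sums of series with distinct orders\<close>

text \<open>Triangular elimination: each step removes the lowest possible coefficient of the
  remainder. Stopping after \<open>K\<close> steps avoids infinite sums.\<close>

lemma fps_expand_leading:
  fixes x :: "nat \<Rightarrow> 'a::comm_ring_1 fps"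
  assumes "\<And>m. fps_X ^ m dvd x m" "\<And>m. x m $ m = 1" and y: "fps_X ^ N dvd y"
  shows "\<exists>c. fps_X ^ (N + K) dvd y - (\<Sum>m\<in>{N..<N + K}. fps_const (c m) * x m)"
proof (induction K)
  case 0
  then show ?case using y by simp
next
  case (Suc K)
  then obtain c where c: "fps_X ^ (N + K) dvd y - (\<Sum>m\<in>{N..<N + K}. fps_const (c m) * x m)"
    (is "_ dvd ?R") by blast
  define c' where "c' = c(N + K := ?R $ (N + K))"
  have "(\<Sum>m\<in>{N..<N + K}. fps_const (c' m) * x m) = (\<Sum>m\<in>{N..<N + K}. fps_const (c m) * x m)"
    by (intro sum.cong) (auto simp: c'_def)
  then have "y - (\<Sum>m\<in>{N..<N + Suc K}. fps_const (c' m) * x m)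
      = ?R - fps_const (?R $ (N + K)) * x (N + K)"
    by (simp add: c'_def)
  moreover have "fps_X ^ (N + Suc K) dvd ?R - fps_const (?R $ (N + K)) * x (N + K)"
    using c assms(1)[of "N + K"] assms(2)[of "N + K"]
    unfolding fps_X_power_dvd_iff_nth by (auto simp: less_Suc_eq)
  ultimately show ?case by metis
qed

text \<open>When the orders are distinct, the lowest term of the sum comes from a single summand and
  cannot cancel.\<close>

lemma subdegree_sum_inj:
  fixes f :: "'b \<Rightarrow> 'a::comm_ring_1 fps"
  assumes "finite A" "\<And>m. m \<in> A \<Longrightarrow> f m \<noteq> 0" "inj_on (\<lambda>m. subdegree (f m)) A" "A \<noteq> {}"
  shows "sum f A \<noteq> 0 \<and> (\<exists>m\<in>A. subdegree (sum f A) = subdegree (f m))"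
  using assms(1,4,2,3)
proof (induction A rule: finite_ne_induct)
  case (insert a A)
  then have IH: "sum f A \<noteq> 0" "\<exists>m\<in>A. subdegree (sum f A) = subdegree (f m)" and a: "f a \<noteq> 0"
    by auto
  from IH(2) insert.prems(2) insert.hyps have "subdegree (f a) \<noteq> subdegree (sum f A)"
    by (metis inj_on_def insertCI)
  then consider "subdegree (f a) < subdegree (sum f A)" | "subdegree (sum f A) < subdegree (f a)"
    by linarith
  then show ?case
  proof cases
    case 1
    then have "subdegree (f a + sum f A) = subdegree (f a)" by (rule subdegree_add_eq1[OF a])
    moreover have "f a + sum f A \<noteq> 0" using 1 a
      by (metis add_eq_0_iff subdegree_uminus less_irrefl)
    ultimately show ?thesis using insert.hyps by simp
  next
    case 2
    then have "subdegree (f a + sum f A) = subdegree (sum f A)" by (rule subdegree_add_eq2[OF IH(1)])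
    moreover have "f a + sum f A \<noteq> 0" using 2 a
      by (metis add_eq_0_iff subdegree_uminus less_irrefl)
    ultimately show ?thesis using insert.hyps IH(2) by simp
  qed
qed simp

section \<open>Sen's congruence modulo powers of \<open>p\<close>\<close>

text \<open>The successor undoes the division by the variable in \<open>i_index\<close>; the
  vanishing constant term makes that division exact.\<close>

lemma i_index_eq_enat_iff:
  fixes h :: "'a::comm_ring_1 fps"
  assumes "h $ 0 = 0"
  shows "i_index p n h = enat i \<longleftrightarrow>
    fps_X ^ Suc i dvd fps_iter h (p ^ n) - fps_X \<and> (fps_iter h (p ^ n) - fps_X) $ Suc i \<noteq> 0"
proof -
  define F where "F = fps_iter h (p ^ n) - fps_X"
  have "F $ 0 = 0" using assms by (simp add: F_def)
  then have "fps_X ^ Suc i dvd F \<longleftrightarrow> fps_X ^ i dvd fps_shift 1 F"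
    by (auto simp: fps_X_power_dvd_iff_nth less_Suc_eq_0_disj simp del: power_Suc)
  then show ?thesis
    unfolding i_index_def fps_ord_def F_def[symmetric]
    using subdegree_eq_iff_fps_X_power_dvd[of "fps_shift 1 F" i] by auto
qed

lemma sen_congruence_step:
  fixes h :: "'a::idom fps" and i :: "nat \<Rightarrow> nat"
  assumes p: "prime p" "CHAR('a) = p" and h: "h $ 0 = 0" "h $ 1 = 1"
    and i: "\<And>j. j \<le> n \<Longrightarrow> i_index p j h = enat (i j)"
    and IH: "\<And>j. 1 \<le> j \<Longrightarrow> j < n \<Longrightarrow> int p ^ j dvd int (i j) - int (i (j - 1))"
    and "n \<ge> 1"
  shows "int p ^ n dvd int (i n) - int (i (n - 1))"
proof (rule ccontr)
  assume contra: "\<not> int p ^ n dvd int (i n) - int (i (n - 1))"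
  have p1: "p > 1" using p(1) prime_gt_1_nat by blast
  let ?v = "multiplicity p"
  let ?x = "iter_prod h"
  let ?D = "\<lambda>f. (f oo h) - f"
  have ord: "fps_X ^ Suc (i j) dvd fps_iter h (p ^ j) - fps_X"
      "(fps_iter h (p ^ j) - fps_X) $ Suc (i j) \<noteq> 0" if "j \<le> n" for j
    using i[OF that] i_index_eq_enat_iff[OF h(1)] by blast+
  have i_pos: "i j \<ge> 1" if "j \<le> n" for j
  proof (rule ccontr)
    assume "\<not> i j \<ge> 1"
    then have "i j = 0" by simp
    then show False using ord(2)[OF that] h fps_iter_nth_1[OF h(1), of "p ^ j"] by simp
  qed
  \<comment> \<open>The differences of consecutive indices from \<open>s\<close> to \<open>t\<close>
    are summed; the weakest modulus among them is \<open>p ^ Suc s\<close>.\<close>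
  have i_cong: "int p ^ Suc s dvd int (i t) - int (i s)" if "s \<le> t" "t < n" for s t
    using that
  proof (induction t rule: dec_induct)
    case (step t)
    have "int p ^ Suc s dvd int p ^ Suc t" using step.hyps by (intro le_imp_power_dvd) simp
    also have "\<dots> dvd int (i (Suc t)) - int (i t)" using IH[of "Suc t"] step.prems by simp
    finally show ?case using dvd_add[OF _ step.IH] step.prems by fastforce
  qed simp
  have iter_mult: "fps_X ^ Suc (i j) dvd fps_iter h (p ^ j * u) - fps_X"
      "(fps_iter h (p ^ j * u) - fps_X) $ Suc (i j)
        = of_nat u * (fps_iter h (p ^ j) - fps_X) $ Suc (i j)"
    if "j \<le> n" for j u
    unfolding fps_iter_mult[OF h(1)]
    using fps_iter_diff_X[of "fps_iter h (p ^ j)" "i j" u] ord[OF that] i_pos[OF that] h(1)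
    by simp_all
  have v_less: "?v m < n \<longleftrightarrow> \<not> p ^ n dvd m" if "m > 0" for m
    using power_dvd_iff_le_multiplicity[of m p n] that p1 by auto
  \<comment> \<open>Write \<open>m = p ^ ?v m * u\<close> with \<open>u\<close> prime to
    \<open>p\<close>; then \<open>of_nat u\<close> is nonzero in the field of coefficients or, more
    generally, in the domain \<open>'a\<close>, so the leading coefficient survives.\<close>
  have Dx: "?D (?x m) \<noteq> 0 \<and> subdegree (?D (?x m)) = m + i (?v m)"
    if m: "m > 0" "?v m \<le> n" for m
  proof -
    obtain u where u: "m = p ^ ?v m * u" "\<not> p dvd u"
      using multiplicity_decompose'[of m p] m(1) p1 by auto
    have "(of_nat u :: 'a) \<noteq> 0" using u(2) p(2) by (simp add: of_nat_eq_0_iff_char_dvd)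
    then have "(fps_iter h m - fps_X) $ Suc (i (?v m)) \<noteq> 0"
      using iter_mult(2)[OF m(2), of u] ord(2)[OF m(2)] u(1) by simp
    moreover have "fps_X ^ Suc (i (?v m)) dvd fps_iter h m - fps_X"
      using iter_mult(1)[OF m(2), of u] u(1) by simp
    ultimately show ?thesis
      unfolding subdegree_eq_iff_fps_X_power_dvd
      using fps_X_power_dvd_iter_prod_diff[OF h] by simp
  qed
  \<comment> \<open>Here the cofactor of \<open>p ^ n\<close> in \<open>m\<close> may be divisible
    by \<open>p\<close>, so only a lower bound is obtained.\<close>
  have Dx_ge: "fps_X ^ (m + i n) dvd ?D (?x m)" if "p ^ n dvd m" for m
    using that iter_mult(1)[of n] by (intro fps_X_power_dvd_iter_prod_diff h) auto
  have no_dvd: False if "m > 0" "?v m < n" "int p ^ Suc (?v m) dvd int m" for m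
  proof -
    have "p ^ Suc (?v m) dvd m"
      using that(3) by (metis int_dvd_int_iff of_nat_power)
    then show False using power_dvd_iff_le_multiplicity[of m p "Suc (?v m)"] that(1) p1 by simp
  qed
  \<comment> \<open>If \<open>?v a < ?v b\<close>, then \<open>p ^ Suc (?v a)\<close> divides both
    \<open>b\<close> and \<open>i (?v b) - i (?v a)\<close>, hence also \<open>a\<close>, which is
    absurd.\<close>
  have inj: "a = b" if "a > 0" "b > 0" "?v a < n" "?v b < n" "?v a \<le> ?v b"
    and eq: "a + i (?v a) = b + i (?v b)" for a b
  proof (cases "?v a = ?v b")
    case False
    then have "int p ^ Suc (?v a) dvd int p ^ ?v b" using that(5) by (intro le_imp_power_dvd) simp
    also have "\<dots> dvd int b"
      by (metis int_dvd_int_iff multiplicity_dvd of_nat_power)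
    finally have "int p ^ Suc (?v a) dvd int b" .
    moreover have "int p ^ Suc (?v a) dvd int (i (?v b)) - int (i (?v a))"
      using i_cong that by blast
    ultimately have "int p ^ Suc (?v a) dvd int b + (int (i (?v b)) - int (i (?v a)))"
      by (rule dvd_add)
    also have "\<dots> = int a" using eq by linarith
    finally show ?thesis using no_dvd that by blast
  qed (use eq in simp)

  define s where "s = multiplicity (int p) (int (i n) - int (i (n - 1)))"
  define d where "d = int (i n) - int (i (n - 1))"
  have d0: "d \<noteq> 0" using contra d_def by auto
  have pu: "\<not> is_unit (int p)" using p1 by simp
  have sn: "s < n" using contra power_dvd_iff_le_multiplicity[OF d0 pu, of n] d_def s_def by auto
  \<comment> \<open>This puts \<open>a + i n\<close> in the residue class of
    \<open>i (n - 1)\<close> modulo \<open>p ^ n\<close>, and \<open>a\<close> has the same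
    valuation \<open>s\<close> as \<open>d\<close>.\<close>
  define a where "a = nat ((- d) mod (int p ^ n))"
  have a_int: "int a = (- d) mod (int p ^ n)" using p1 by (simp add: a_def)
  have a_cong: "int p ^ n dvd int a + d"
    unfolding a_int by (metis dvd_minus_mod dvd_minus_iff minus_diff_eq diff_minus_eq_add add.commute)
  have va: "int p ^ t dvd int a \<longleftrightarrow> int p ^ t dvd d" if "t \<le> n" for t
  proof -
    have "int p ^ t dvd int a + d" using a_cong le_imp_power_dvd[OF that] dvd_trans by blast
    then show ?thesis by (metis dvd_add_left_iff dvd_add_right_iff)
  qed
  have a_pos: "a > 0" using va[of n] contra d_def by (cases "a = 0") auto
  have sdvd: "int p ^ s dvd d" unfolding s_def d_def by (rule multiplicity_dvd)
  have sndvd: "\<not> int p ^ Suc s dvd d"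
    using power_dvd_iff_le_multiplicity[OF d0 pu, of "Suc s"] d_def s_def by auto
  have a_s: "p ^ s dvd a" "\<not> p ^ Suc s dvd a"
    using va[of s] va[of "Suc s"] sdvd sndvd sn by (metis int_dvd_int_iff of_nat_power less_imp_le Suc_leI)+
  have pn: "p ^ n = p ^ (n - s) * p ^ s" using sn by (simp flip: power_add)
  obtain b where b: "a = p ^ s * b" "\<not> p dvd b" 
  proof -
    obtain b where "a = p ^ s * b" using a_s(1) by blast
    then show ?thesis using that a_s(2) by (metis mult_dvd_mono dvd_refl power_Suc2)
  qed

  define \<rho> where "\<rho> = fps_iter h (p ^ (n - s))"
  have \<rho>: "\<rho> $ 0 = 0" "\<rho> $ 1 = 1"
    using h fps_iter_nth_1[OF h(1), of "p ^ (n - s)"] by (simp_all add: \<rho>_def)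
  define w where "w = iter_prod \<rho> a"
  \<comment> \<open>Since \<open>p\<close> does not divide \<open>b\<close>, this iterate differs
    from the identity in order exactly \<open>Suc (i n)\<close>.\<close>
  have \<rho>a: "fps_iter \<rho> a = fps_iter h (p ^ n * b)"
    unfolding \<rho>_def b(1) fps_iter_mult[OF h(1), symmetric] by (simp add: pn mult_ac)
  have w: "fps_X ^ (a + i n) dvd (w oo \<rho>) - w" "((w oo \<rho>) - w) $ (a + i n) \<noteq> 0"
  proof -
    have 1: "fps_X ^ Suc (i n) dvd fps_iter \<rho> a - fps_X"
      unfolding \<rho>a using iter_mult(1) by blast
    have "(of_nat b :: 'a) \<noteq> 0" using b(2) p(2) by (simp add: of_nat_eq_0_iff_char_dvd)
    then have 2: "(fps_iter \<rho> a - fps_X) $ Suc (i n) \<noteq> 0"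
      unfolding \<rho>a using iter_mult(2)[of n b] ord(2)[of n] by simp
    show "fps_X ^ (a + i n) dvd (w oo \<rho>) - w" "((w oo \<rho>) - w) $ (a + i n) \<noteq> 0"
      unfolding w_def using fps_X_power_dvd_iter_prod_diff[OF \<rho> 1] 2 by simp_all
  qed
  define y where "y = (\<Sum>j<p ^ (n - s). w oo fps_iter h j)"
  \<comment> \<open>All summands of \<open>y\<close> have the leading term of \<open>w\<close>, and their number vanishes in characteristic \<open>p\<close>.\<close>
  have y_dvd: "fps_X ^ Suc a dvd y"
  proof -
    have "fps_X ^ Suc a dvd (w oo fps_iter h j) - w" for j
    proof -
      have "fps_X ^ Suc 1 dvd fps_iter h j - fps_X"
        using h fps_iter_nth_1[OF h(1), of j]
        by (auto simp: fps_X_power_dvd_iff_nth less_Suc_eq simp del: power_Suc)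
      moreover have "fps_X ^ a dvd w" unfolding w_def by (rule iter_prod_leading[OF \<rho>])
      ultimately show ?thesis using fps_X_power_dvd_compose_diff[of 1] by fastforce
    qed
    then have "fps_X ^ Suc a dvd (\<Sum>j<p ^ (n - s). (w oo fps_iter h j) - w)" by (rule dvd_sum)
    also have "(\<Sum>j<p ^ (n - s). (w oo fps_iter h j) - w) = y - of_nat (p ^ (n - s)) * w"
      by (simp add: y_def sum_subtractf)
    also have "(of_nat (p ^ (n - s)) :: 'a fps) = fps_const (of_nat (p ^ (n - s)))"
      by (simp only: fps_of_nat)
    also have "(of_nat (p ^ (n - s)) :: 'a) = 0"
      using p(2) sn by (simp add: of_nat_eq_0_iff_char_dvd)
    finally show ?thesis by simp
  qed
  \<comment> \<open>Composition with \<open>h\<close> shifts the summands of \<open>y\<close> by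
    one, so only the two end terms remain.\<close>
  have Dy: "?D y = (w oo \<rho>) - w"
  proof -
    have "?D y = (\<Sum>j<p ^ (n - s). (w oo fps_iter h (Suc j)) - (w oo fps_iter h j))"
      unfolding y_def fps_compose_sum_distrib sum_subtractf[symmetric]
      using fps_iter_add[OF h(1), of _ 1] h(1)
      by (simp add: fps_iter_Suc fps_compose_assoc)
    also have "\<dots> = (w oo \<rho>) - w"
      by (subst sum_lessThan_telescope) (simp add: \<rho>_def)
    finally show ?thesis .
  qed

  \<comment> \<open>Expanding over \<open>i n\<close> terms leaves a remainder of order above
    \<open>a + i n\<close>, the order of \<open>?D y\<close>; \<open>?D\<close> preserves this
    bound.\<close>
  obtain c where c: "fps_X ^ (Suc a + i n) dvd
      y - (\<Sum>m\<in>{Suc a..<Suc a + i n}. fps_const (c m) * ?x m)" (is "_ dvd ?R")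
    using fps_expand_leading[OF iter_prod_leading[OF h] y_dvd] by blast
  define M where "M = {Suc a..<Suc a + i n}"
  define A where "A = {m\<in>M. c m \<noteq> 0 \<and> \<not> p ^ n dvd m}"
  let ?f = "\<lambda>m. fps_const (c m) * ?D (?x m)"
  have "y = ?R + (\<Sum>m\<in>M. fps_const (c m) * ?x m)" by (simp add: M_def)
  then have "?D y = ?D (?R + (\<Sum>m\<in>M. fps_const (c m) * ?x m))" by simp
  also have "\<dots> = ?D ?R + (\<Sum>m\<in>M. ?f m)"
    by (simp only: fps_compose_add_distrib fps_compose_sum_distrib
          fps_compose_mult_distrib[OF h(1)] fps_const_compose right_diff_distrib sum_subtractf) simp
  also have "(\<Sum>m\<in>M. ?f m) = (\<Sum>m\<in>{m\<in>M. p ^ n dvd m}. ?f m) + (\<Sum>m\<in>{m\<in>M. \<not> p ^ n dvd m}. ?f m)"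
  proof -
    have "M = {m\<in>M. p ^ n dvd m} \<union> {m\<in>M. \<not> p ^ n dvd m}" by auto
    then show ?thesis by (metis (no_types, lifting) sum.union_disjoint M_def finite_atLeastLessThan
        finite_Un disjoint_iff mem_Collect_eq)
  qed
  also have "(\<Sum>m\<in>{m\<in>M. \<not> p ^ n dvd m}. ?f m) = sum ?f A"
    by (rule sum.mono_neutral_right) (auto simp: A_def M_def)
  finally have Dy_sum: "?D y = ?D ?R + ((\<Sum>m\<in>{m\<in>M. p ^ n dvd m}. ?f m) + sum ?f A)" .
  have "fps_X ^ (Suc a + i n) dvd ?D ?R"
    by (intro dvd_diff fps_X_power_dvd_compose(1) h(1) c)
  moreover have "fps_X ^ (Suc a + i n) dvd (\<Sum>m\<in>{m\<in>M. p ^ n dvd m}. ?f m)"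
  proof (rule dvd_sum)
    fix m assume "m \<in> {m\<in>M. p ^ n dvd m}"
    then have "fps_X ^ (m + i n) dvd ?D (?x m)" "Suc a \<le> m" using Dx_ge by (auto simp: M_def)
    then show "fps_X ^ (Suc a + i n) dvd ?f m"
      by (intro dvd_mult) (erule fps_X_power_dvd_mono, simp)
  qed
  ultimately have "fps_X ^ (Suc a + i n) dvd ?D ?R + (\<Sum>m\<in>{m\<in>M. p ^ n dvd m}. ?f m)"
    by (rule dvd_add)
  also have "\<dots> = ?D y - sum ?f A"
    unfolding Dy_sum add.assoc[symmetric] by (rule add_diff_cancel_right'[symmetric])
  finally have "fps_X ^ (Suc a + i n) dvd ?D y - sum ?f A" .
  then have "sum ?f A $ k = ?D y $ k" if "k \<le> a + i n" for k
    using that unfolding fps_X_power_dvd_iff_nth by (simp add: less_Suc_eq_le)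
  then have "fps_X ^ (a + i n) dvd sum ?f A \<and> sum ?f A $ (a + i n) \<noteq> 0"
    using w unfolding Dy fps_X_power_dvd_iff_nth by simp
  then have S: "sum ?f A \<noteq> 0" "subdegree (sum ?f A) = a + i n"
    using subdegree_eq_iff_fps_X_power_dvd by blast+
  have A: "finite A" "\<And>m. m \<in> A \<Longrightarrow> m > 0 \<and> ?v m < n"
    using v_less by (auto simp: A_def M_def)
  have f: "?f m \<noteq> 0" "subdegree (?f m) = m + i (?v m)" if "m \<in> A" for m
  proof -
    have "?D (?x m) \<noteq> 0" "subdegree (?D (?x m)) = m + i (?v m)" "c m \<noteq> 0"
      using Dx[of m] A(2)[OF that] that by (auto simp: A_def)
    then show "?f m \<noteq> 0" "subdegree (?f m) = m + i (?v m)" by simp_all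
  qed
  have "inj_on (\<lambda>m. subdegree (?f m)) A"
  proof (rule inj_onI)
    fix m m' assume "m \<in> A" "m' \<in> A" "subdegree (?f m) = subdegree (?f m')"
    then have "m + i (?v m) = m' + i (?v m')" using f(2) by metis
    then show "m = m'"
      using inj[of m m'] inj[of m' m] A(2) \<open>m \<in> A\<close> \<open>m' \<in> A\<close> by (metis nat_le_linear)
  qed
  moreover have "A \<noteq> {}"
  proof
    assume "A = {}"
    then have "sum ?f A = 0" by (simp only: sum.empty)
    then show False using S(1) by contradiction
  qed
  ultimately have "\<exists>m\<in>A. subdegree (sum ?f A) = subdegree (?f m)"
    by (intro conjunct2[OF subdegree_sum_inj[OF A(1) f(1)]])
  then obtain m where m: "m \<in> A" "subdegree (sum ?f A) = subdegree (?f m)" by (rule bexE)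
  have am: "a + i n = m + i (?v m)"
    using m(2) unfolding S(2) f(2)[OF m(1)] .
  have vm: "m > 0" "?v m < n" using A(2)[OF m(1)] by auto
  \<comment> \<open>Modulo \<open>p ^ Suc (?v m)\<close>, the order \<open>a + i n\<close> is
    congruent to \<open>i (n - 1)\<close> and so to \<open>i (?v m)\<close>. This forces
    \<open>m\<close> to be divisible by \<open>p ^ Suc (?v m)\<close>.\<close>
  have "int p ^ Suc (?v m) dvd int p ^ n" using vm(2) by (intro le_imp_power_dvd) simp
  also note a_cong
  finally have "int p ^ Suc (?v m) dvd int a + d" .
  moreover have "int p ^ Suc (?v m) dvd int (i (n - 1)) - int (i (?v m))"
    using i_cong[of "?v m" "n - 1"] vm(2) by simp
  ultimately have "int p ^ Suc (?v m) dvd (int a + d) + (int (i (n - 1)) - int (i (?v m)))"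
    by (rule dvd_add)
  also have "\<dots> = int m" using am unfolding d_def by linarith
  finally show False using no_dvd vm by blast
qed

text \<open>An infinite index means that the iterate is the identity, and then so is its
  \<open>p\<close>-th iterate.\<close>

lemma i_index_finite_pred:
  fixes h :: "'a::idom fps"
  assumes "h $ 0 = 0" "i_index p (Suc n) h \<noteq> \<infinity>"
  shows "i_index p n h \<noteq> \<infinity>"
proof
  assume inf: "i_index p n h = \<infinity>"
  have "fps_iter h (p ^ n) - fps_X = 0"
  proof (rule fps_ext)
    fix k
    show "(fps_iter h (p ^ n) - fps_X) $ k = 0 $ k"
    proof (cases k)
      case (Suc l)
      have "fps_shift 1 (fps_iter h (p ^ n) - fps_X) = 0"
        using inf by (simp add: i_index_def fps_ord_def split: if_splits)
      then have "fps_shift 1 (fps_iter h (p ^ n) - fps_X) $ l = 0" by simp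
      then show ?thesis by (simp add: Suc)
    qed (use assms in simp)
  qed
  then have "fps_iter h (p ^ n) = fps_X" by simp
  moreover have "fps_iter (fps_X :: 'a fps) m = fps_X" for m
    by (induction m) (simp_all add: fps_iter_Suc)
  ultimately have "fps_iter h (p ^ Suc n) = fps_X"
    using fps_iter_mult[OF assms(1), of "p ^ n" p] by (simp add: mult.commute)
  then show False using assms(2) by (simp add: i_index_def fps_ord_def)
qed

theorem sen_congruence:
  fixes h :: "'a::idom fps"
  assumes p: "prime p" "CHAR('a) = p" and h: "h $ 0 = 0" "h $ 1 = 1"
    and "i_index p (Suc n) h \<noteq> \<infinity>"
  shows "int p ^ Suc n dvd int (the_enat (i_index p (Suc n) h)) - int (the_enat (i_index p n h))"
  using assms(5)
\<comment> \<open>Strong induction is used because the step needs the congruences at all lower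
  levels.\<close>
proof (induction n rule: less_induct)
  case (less n)
  have fin: "i_index p j h \<noteq> \<infinity>" if "j \<le> Suc n" for j
    using that by (induction j rule: inc_induct) (use less.prems i_index_finite_pred[OF h(1)] in blast)+
  have "int p ^ Suc n dvd int (the_enat (i_index p (Suc n) h)) -
    int (the_enat (i_index p (Suc n - 1) h))"
  proof (rule sen_congruence_step[OF p h, where i = "\<lambda>j. the_enat (i_index p j h)"])
    fix j assume "1 \<le> j" "j < Suc n"
    then show "int p ^ j dvd int (the_enat (i_index p j h)) - int (the_enat (i_index p (j - 1) h))"
      using less.IH[of "j - 1"] fin[of j] by simp
  next
    fix j assume "j \<le> Suc n"
    then show "i_index p j h = enat (the_enat (i_index p j h))"
      using fin[of j] by (cases "i_index p j h") auto
  qed simp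
  then show ?case by simp
qed

section \<open>The multiplier and divisibility by \<open>q\<close>\<close>

text \<open>Let \<open>c\<close> be the leading coefficient of \<open>E = h - fps_X\<close>. For
  \<open>i > 0\<close>, compare degree \<open>Suc i\<close> in \<open>(g oo h) - g = E oo g\<close>:
  the left side gives \<open>g $ 1 * c\<close>, as the part of \<open>g\<close> of order at least 2
  contributes only later, and the right side gives \<open>c * (g $ 1) ^ Suc i\<close>.\<close>

lemma multiplier_power_eq_1_of_commute:
  fixes g h :: "'a::idom fps"
  assumes g: "g $ 0 = 0" "g $ 1 \<noteq> 0" and h: "fps_X ^ Suc i dvd h - fps_X" "(h - fps_X) $ Suc i \<noteq> 0"
    and comm: "g oo h = h oo g"
  shows "(g $ 1) ^ i = 1"
proof -
  define E where "E = h - fps_X"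
  define g2 where "g2 = g - fps_const (g $ 1) * fps_X"
  have gX: "g = fps_const (g $ 1) * fps_X + g2" by (simp add: g2_def)
  show ?thesis
  proof (cases "i = 0")
    case False
    then have h0: "h $ 0 = 0" using h(1) by (auto simp: fps_X_power_dvd_iff_nth simp del: power_Suc)
    have "fps_X ^ 2 dvd g2"
      using g(1) less_2_cases by (auto simp: g2_def fps_X_power_dvd_iff_nth)
    then have "fps_X ^ (2 + i) dvd (g2 oo h) - g2"
      using fps_X_power_dvd_compose_diff[OF h(1)] by blast
    then have g2: "((g2 oo h) - g2) $ Suc i = 0" unfolding fps_X_power_dvd_iff_nth by simp
    have "(g oo h) - g = fps_const (g $ 1) * E + ((g2 oo h) - g2)"
      by (subst (1 2) gX) (simp add: fps_compose_add_distrib fps_compose_mult_distrib h0 E_def algebra_simps)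
    then have "((g oo h) - g) $ Suc i = g $ 1 * E $ Suc i" using g2 by simp
    moreover have "(g oo h) - g = E oo g"
      unfolding comm E_def by (simp add: fps_compose_sub_distrib g(1))
    moreover have "(E oo g) $ Suc i = E $ Suc i * (g $ 1) ^ Suc i"
      using fps_X_power_dvd_compose(2)[OF g(1)] h(1) E_def by blast
    ultimately show ?thesis using g(2) h(2) by (simp add: E_def)
  qed simp
qed

text \<open>If \<open>q = r * p\<close>, the Frobenius map gives
  \<open>(\<gamma> ^ r - 1) ^ p = \<gamma> ^ q - 1 = 0\<close>, so already
  \<open>\<gamma> ^ r = 1\<close> with \<open>r < q\<close>.\<close>

lemma coprime_char_of_primitive_root:
  fixes \<gamma> :: "'a::idom"
  assumes p: "prime p" "CHAR('a) = p" and "q \<ge> 1" "\<gamma> ^ q = 1"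
    and prim: "\<forall>m. 0 < m \<and> m < q \<longrightarrow> \<gamma> ^ m \<noteq> 1"
  shows "coprime q p"
proof (rule ccontr)
  assume "\<not> coprime q p"
  then have "p dvd q" using p(1) by (metis coprime_commute prime_imp_coprime)
  then obtain r where r: "q = r * p" by (metis dvdE mult.commute)
  have "\<gamma> ^ q = ((\<gamma> ^ r - 1) + 1) ^ p" by (simp add: r power_mult)
  also have "\<dots> = (\<gamma> ^ r - 1) ^ p + 1"
    using freshmans_dream[where x = "\<gamma> ^ r - 1" and y = 1] p by simp
  finally have "(\<gamma> ^ r - 1) ^ p = 0" using assms(4) by simp
  then have "\<gamma> ^ r = 1" by simp
  moreover have "0 < r" "r < q" using assms(3) r prime_gt_1_nat[OF p(1)] by auto
  ultimately show False using prim by blast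
qed

theorem theoremD:
  fixes p q :: nat and \<gamma> :: "'a::field" and g :: "'a fps"
  assumes "prime p" and "CHAR('a) = p"
    and "q \<ge> 1" and "\<gamma> ^ q = 1" and "\<forall>m. 0 < m \<and> m < q \<longrightarrow> \<gamma> ^ m \<noteq> 1"
    and "fps_nth g 0 = 0" and "fps_nth g 1 = \<gamma>"
  shows "(i_index p 0 (fps_iter g q) \<noteq> \<infinity> \<longrightarrow> q dvd the_enat (i_index p 0 (fps_iter g q)))
    \<and> (\<forall>n\<ge>1. i_index p n (fps_iter g q) \<noteq> \<infinity> \<longrightarrow>
          i_index p (n - 1) (fps_iter g q) \<noteq> \<infinity> \<and>
          the_enat (i_index p n (fps_iter g q)) mod (q * p ^ n) = the_enat (i_index p (n - 1) (fps_iter g q)) mod (q * p ^ n))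
    \<and> (\<forall>n. i_index p n (fps_iter g q) \<noteq> \<infinity> \<longrightarrow> q dvd the_enat (i_index p n (fps_iter g q)))"
proof -
  define h where "h = fps_iter g q"
  have h: "h $ 0 = 0" "h $ 1 = 1"
    using assms fps_iter_nth_1[of g q] by (simp_all add: h_def)
  have \<gamma>0: "\<gamma> \<noteq> 0" using assms(3,4) by (auto simp: power_0_left)
  have q_dvd: "q dvd the_enat (i_index p n h)" if fin: "i_index p n h \<noteq> \<infinity>" for n
  proof -
    define i where "i = the_enat (i_index p n h)"
    have "i_index p n h = enat i" using fin by (auto simp: i_def)
    then have *: "fps_X ^ Suc i dvd fps_iter h (p ^ n) - fps_X"
        "(fps_iter h (p ^ n) - fps_X) $ Suc i \<noteq> 0"
      using i_index_eq_enat_iff[OF h(1)] by blast+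
    \<comment> \<open>Both sides are the iterate of \<open>g\<close> with exponent
      \<open>q * p ^ n + 1\<close>.\<close>
    have "g oo fps_iter h (p ^ n) = fps_iter h (p ^ n) oo g"
      unfolding h_def fps_iter_mult[OF assms(6), symmetric]
      using fps_iter_add[OF assms(6), of "q * p ^ n" 1] fps_iter_Suc[of g "q * p ^ n"]
        fps_iter_Suc[of g 0] by simp
    then have "\<gamma> ^ i = 1"
      using multiplier_power_eq_1_of_commute[OF assms(6) _ *] \<gamma>0 assms(7) by simp
    moreover have "\<gamma> ^ i = \<gamma> ^ (i mod q)"
    proof -
      have "\<gamma> ^ i = \<gamma> ^ (q * (i div q) + i mod q)" by simp
      also have "\<dots> = \<gamma> ^ (i mod q)" unfolding power_add power_mult using assms(4) by simp
      finally show ?thesis .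
    qed
    ultimately have "i mod q = 0"
      using assms(3,5) by (metis gr0I mod_less_divisor less_eq_Suc_le One_nat_def)
    then show ?thesis unfolding i_def by auto
  qed
  have step: "i_index p (n - 1) h \<noteq> \<infinity> \<and>
      the_enat (i_index p n h) mod (q * p ^ n) = the_enat (i_index p (n - 1) h) mod (q * p ^ n)"
    if "n \<ge> 1" and fin: "i_index p n h \<noteq> \<infinity>" for n
  proof -
    obtain k where k: "n = Suc k" using \<open>n \<ge> 1\<close> by (cases n) auto
    have fin': "i_index p k h \<noteq> \<infinity>" using i_index_finite_pred[OF h(1)] fin k by blast
    let ?a = "the_enat (i_index p n h)" and ?b = "the_enat (i_index p k h)"
    have "int (p ^ n) dvd int ?a - int ?b"
      using sen_congruence[OF assms(1,2) h, of k] fin k by simp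
    \<comment> \<open>Both indices vanish modulo \<open>q\<close>; coprimality of \<open>q\<close>
      and \<open>p ^ n\<close> then joins the two congruences.\<close>
    moreover have "[?a = ?b] (mod q)"
      using q_dvd[OF fin] q_dvd[OF fin'] by (simp add: cong_def)
    moreover have "coprime q (p ^ n)"
      using coprime_char_of_primitive_root[OF assms(1-5)] by simp
    ultimately have "[?a = ?b] (mod q * p ^ n)"
      by (metis coprime_cong_mult_nat cong_int_iff cong_iff_dvd_diff)
    then show ?thesis using fin' k by (simp add: cong_def)
  qed
  show ?thesis using q_dvd step unfolding h_def by blast
qed

end
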